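(* Let $0<q<1$ and $a,b,c,d\in\mathbb{C}$. For a symmetric Laurent polynomial $f[z]$ define $$(Lf)[z]:=\frac{(1-az)(1-bz)(1-cz)(1-dz)\,z^{-2}\,f[qz]-(1-a/z)(1-b/z)(1-c/z)(1-d/z)\,z^{2}\,f[q^{-1}z]}{z-z^{-1}}.$$ Then, as an identity of meromorphic functions of $z\in\mathbb{C}\setminus\{0\}$, $$(Lf)[z]=\tfrac12(1-q^2)\,\frac{(az,az^{-1},bz,bz^{-1},cz,cz^{-1},dz,dz^{-1};q^2)_\infty}{(qz^2,qz^{-2};q^2)_\infty}\;\frac{\delta_{q^2}}{\delta_{q^2}x}\left(\frac{(qz^2,qz^{-2};q^2)_\infty\,f[z]}{(qaz,qaz^{-1},qbz,qbz^{-1},qcz,qcz^{-1},qdz,qdz^{-1};q^2)_\infty}\right).$$ Moreover $L=[D,X]=DX-XD$ on symmetric Laurent polynomials, where $X$ is multiplication by $x=\tfrac12(z+z^{-1})$ and $D$ is the Askey-Wilson second order $q$-difference operator determined by $$\tfrac12(1-q^{-1})(Df)[z]=v(z)f[qz]-\bigl(v(z)+v(z^{-1})\bigr)f[z]+v(z^{-1})f[q^{-1}z],\qquad v(z)=\frac{(1-az)(1-bz)(1-cz)(1-dz)}{(1-z^2)(1-qz^2)}.$$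
   Context: A symmetric Laurent polynomial is $f[z]=\sum_{k=-n}^n c_kz^k$ with $c_k=c_{-k}$. Notation: $(u;q)_\infty=\prod_{j\ge0}(1-uq^j)$ and $(u_1,\dots,u_r;q)_\infty=\prod_i(u_i;q)_\infty$. The divided $q$-difference operator is $$\frac{\delta_q}{\delta_q x}\,g[z]:=\frac{2\bigl(g[q^{1/2}z]-g[q^{-1/2}z]\bigr)}{(q^{1/2}-q^{-1/2})(z-z^{-1})},$$ so that $\frac{\delta_{q^2}}{\delta_{q^2}x}g[z]=\frac{2(g[qz]-g[q^{-1}z])}{(q-q^{-1})(z-z^{-1})}$. *)

theory Defs
  imports "HOL-Complex_Analysis.Complex_Analysis"
begin

(* Laurent polynomials are represented as functions on the complex plane; their value at the
   point 0, which lies outside the domain C - {0}, is arbitrary and is never inspected. *)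
definition symmetric_laurent_poly :: "(complex \<Rightarrow> complex) \<Rightarrow> bool" where
  "symmetric_laurent_poly f \<longleftrightarrow>
     (\<exists>(n::nat) (c :: int \<Rightarrow> complex). (\<forall>k. c k = c (- k)) \<and>
        (\<forall>z. z \<noteq> 0 \<longrightarrow> f z = (\<Sum>k = - int n..int n. c k * z powi k)))"

(* Equality of meromorphic functions on C - {0}: library functions are total and take arbitrary
   values at poles and removable singularities, so equality is required off a set without
   accumulation points in C - {0}. *)
definition meromorphic_eq :: "(complex \<Rightarrow> complex) \<Rightarrow> (complex \<Rightarrow> complex) \<Rightarrow> bool" where
  "meromorphic_eq g h \<longleftrightarrow>
     g meromorphic_on (- {0}) \<and> h meromorphic_on (- {0}) \<and> (\<forall>\<^sub>\<approx>z\<in>- {0}. g z = h z)"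

definition qpoch_inf :: "complex \<Rightarrow> real \<Rightarrow> complex" where
  "qpoch_inf u q = (\<Prod>j. 1 - u * complex_of_real q ^ j)"

definition qpochs_inf :: "complex list \<Rightarrow> real \<Rightarrow> complex" where
  "qpochs_inf us q = (\<Prod>u\<leftarrow>us. qpoch_inf u q)"

definition divided_qdiff :: "real \<Rightarrow> (complex \<Rightarrow> complex) \<Rightarrow> complex \<Rightarrow> complex" where
  "divided_qdiff q g z =
     2 * (g (complex_of_real (q powr (1/2)) * z) - g (complex_of_real (q powr (- 1/2)) * z)) /
     (complex_of_real (q powr (1/2) - q powr (- 1/2)) * (z - inverse z))"

definition L_op :: "real \<Rightarrow> complex \<Rightarrow> complex \<Rightarrow> complex \<Rightarrow> complex \<Rightarrow>
    (complex \<Rightarrow> complex) \<Rightarrow> complex \<Rightarrow> complex" where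
  "L_op q a b c d f z =
     ((1 - a*z) * (1 - b*z) * (1 - c*z) * (1 - d*z) * z powi (-2) * f (complex_of_real q * z)
      - (1 - a/z) * (1 - b/z) * (1 - c/z) * (1 - d/z) * z\<^sup>2 * f (inverse (complex_of_real q) * z))
     / (z - inverse z)"

definition X_op :: "(complex \<Rightarrow> complex) \<Rightarrow> complex \<Rightarrow> complex" where
  "X_op f z = (z + inverse z) / 2 * f z"

definition AW_v :: "real \<Rightarrow> complex \<Rightarrow> complex \<Rightarrow> complex \<Rightarrow> complex \<Rightarrow> complex \<Rightarrow> complex" where
  "AW_v q a b c d z =
     (1 - a*z) * (1 - b*z) * (1 - c*z) * (1 - d*z) / ((1 - z\<^sup>2) * (1 - complex_of_real q * z\<^sup>2))"

(* The operator is an endomorphism of the space of symmetric Laurent polynomials; the equation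
   determines each image uniquely on C - {0}, because the image is continuous there. *)
definition askey_wilson_operator :: "real \<Rightarrow> complex \<Rightarrow> complex \<Rightarrow> complex \<Rightarrow> complex \<Rightarrow>
    ((complex \<Rightarrow> complex) \<Rightarrow> complex \<Rightarrow> complex) \<Rightarrow> bool" where
  "askey_wilson_operator q a b c d D \<longleftrightarrow>
     (\<forall>f. symmetric_laurent_poly f \<longrightarrow>
        symmetric_laurent_poly (D f) \<and>
        meromorphic_eq
          (\<lambda>z. 1/2 * (1 - inverse (complex_of_real q)) * D f z)
          (\<lambda>z. AW_v q a b c d z * f (complex_of_real q * z)
               - (AW_v q a b c d z + AW_v q a b c d (inverse z)) * f z
               + AW_v q a b c d (inverse z) * f (inverse (complex_of_real q) * z)))"

end

(* The recurrence (u;p) = (1-u)(pu;p) with p = q^2 makes every ratio of gauge factors at z and at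
   qz or z/q elementary: each parameter contributes 1-az resp. 1-a/z, while the factor
   (qz^2, q/z^2; p) contributes -1/(qz^2) resp. -z^2/q.

   For the existence of D, A(z)(f(qz)-f(z)) with A(z) = (1-az)(1-bz)(1-cz)(1-dz) vanishes at the
   roots of qz^2 = 1, because there qz = 1/z; write it as (1-qz^2)P(z). What remains,
   (P(z) - z^2 P(1/z))/(1-z^2), is a Laurent polynomial because its numerator vanishes at 1 and -1.
   In the commutator the terms containing f(z) cancel, and x(qz)-x(z) cancels the factor 1-qz^2
   of the denominator of v. *)

theory Submission
  imports Defs
begin

section \<open>The infinite q-Pochhammer symbol\<close>

lemma convergent_qpoch:
  fixes u :: complex and q :: real
  assumes "0 < q" "q < 1"
  shows "convergent_prod (\<lambda>j. 1 - u * complex_of_real q ^ j)"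
proof -
  have "summable (\<lambda>j. norm u * q ^ j)"
    using assms by (intro summable_mult summable_geometric) auto
  then have "summable (\<lambda>j. norm (1 - u * complex_of_real q ^ j - 1))"
    using assms by (simp add: norm_mult norm_power)
  then show ?thesis
    by (intro abs_convergent_prod_imp_convergent_prod) (simp add: abs_convergent_prod_conv_summable)
qed

lemma qpoch_inf_rec:
  assumes "0 < q" "q < 1"
  shows "qpoch_inf u q = (1 - u) * qpoch_inf (complex_of_real q * u) q"
proof -
  have "(\<lambda>j. 1 - u * complex_of_real q ^ j) has_prod
          ((\<Prod>k<1. 1 - u * complex_of_real q ^ k) * (\<Prod>k. 1 - u * complex_of_real q ^ (k + 1)))"
    by (rule has_prod_ignore_initial_segment' [OF convergent_qpoch [OF assms]])
  then have "qpoch_inf u q = (1 - u) * (\<Prod>k. 1 - u * complex_of_real q ^ (k + 1))"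
    unfolding qpoch_inf_def using has_prod_unique by fastforce
  also have "(\<lambda>k. 1 - u * complex_of_real q ^ (k + 1))
           = (\<lambda>k. 1 - (complex_of_real q * u) * complex_of_real q ^ k)"
    by (simp add: mult_ac)
  finally show ?thesis by (simp add: qpoch_inf_def)
qed

lemma qpoch_inf_nonzero:
  assumes "0 < q" "q < 1" "norm u < 1"
  shows "qpoch_inf u q \<noteq> 0"
  unfolding qpoch_inf_def
proof (rule prodinf_nonzero [OF convergent_qpoch])
  fix j
  have "norm (u * complex_of_real q ^ j) \<le> norm u * 1"
    unfolding norm_mult using assms
    by (intro mult_left_mono) (auto simp: norm_power power_le_one)
  then have "norm (u * complex_of_real q ^ j) \<noteq> norm (1::complex)"
    using assms by simp
  then show "1 - u * complex_of_real q ^ j \<noteq> 0" by force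
qed (use assms in auto)

section \<open>Holomorphy of the Pochhammer symbol in its argument\<close>

lemma uniform_limit_qpoch:
  assumes q: "0 < q" "q < 1"
  shows "uniform_limit (cball 0 R) (\<lambda>N u. \<Prod>j<N. 1 - u * complex_of_real q ^ j)
           (\<lambda>u. qpoch_inf u q) sequentially"
proof -
  let ?P = "\<lambda>N u. \<Prod>j<N. 1 - u * complex_of_real q ^ j"
  have "uniformly_convergent_on (cball 0 R) ?P"
  proof (rule uniformly_convergent_on_prod')
    show "uniformly_convergent_on (cball 0 R)
            (\<lambda>N u. \<Sum>j<N. norm (1 - u * complex_of_real q ^ j - 1))"
    \<comment> \<open>On the disc of radius R the deviation of the j-th factor from 1 is at most R
      q^j, a geometric majorant independent of u.\<close>
    proof (rule Weierstrass_m_test')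
      show "norm (norm (1 - u * complex_of_real q ^ j - 1)) \<le> R * q ^ j"
        if "u \<in> cball 0 R" for j u
        using that q by (auto simp: norm_mult norm_power intro!: mult_right_mono)
      show "summable (\<lambda>j. R * q ^ j)"
        using q by (intro summable_mult summable_geometric) auto
    qed
  qed (auto intro!: continuous_intros)
  then obtain g where g: "uniform_limit (cball 0 R) ?P g sequentially"
    by (auto simp: uniformly_convergent_on_def)
  have "g u = qpoch_inf u q" if "u \<in> cball 0 R" for u
  proof (rule LIMSEQ_unique)
    \<comment> \<open>The shift to \<open>Suc n\<close> matches the library's partial products,
      which run over indices up to and including n.\<close>
    show "(\<lambda>n. ?P (Suc n) u) \<longlonglongrightarrow> g u"
      using tendsto_uniform_limitI [OF g that] by (rule LIMSEQ_Suc)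
    show "(\<lambda>n. ?P (Suc n) u) \<longlonglongrightarrow> qpoch_inf u q"
      using convergent_prod_LIMSEQ [OF convergent_qpoch [OF q, of u]]
      unfolding qpoch_inf_def lessThan_Suc_atMost .
  qed
  with g show ?thesis
    using uniform_limit_cong' by (metis (no_types, lifting))
qed

text \<open>The partial products are polynomials in u converging uniformly on every closed disc, so
  the symbol is entire; composition with f does the rest.\<close>

lemma analytic_on_qpoch_inf:
  assumes q: "0 < q" "q < 1" and f: "f analytic_on A"
  shows "(\<lambda>z. qpoch_inf (f z) q) analytic_on A"
proof -
  have "(\<lambda>u. qpoch_inf u q) holomorphic_on UNIV"
  proof (rule holomorphic_uniform_sequence)
    fix z :: complex
    have "uniform_limit (cball z 1) (\<lambda>N u. \<Prod>j<N. 1 - u * complex_of_real q ^ j)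
            (\<lambda>u. qpoch_inf u q) sequentially"
      by (rule uniform_limit_on_subset [OF uniform_limit_qpoch [OF q, of "norm z + 1"]])
         (simp add: cball_subset_cball_iff)
    then show "\<exists>d>0. cball z d \<subseteq> UNIV \<and> uniform_limit (cball z d)
        (\<lambda>N u. \<Prod>j<N. 1 - u * complex_of_real q ^ j) (\<lambda>u. qpoch_inf u q) sequentially"
      by (intro exI [of _ 1]) auto
  qed (auto intro!: holomorphic_intros)
  then have "(\<lambda>u. qpoch_inf u q) analytic_on UNIV"
    by (simp add: analytic_on_open)
  from analytic_on_compose_gen [OF f this] show ?thesis
    by (simp add: o_def)
qed

section \<open>Nonvanishing of Pochhammer symbols off a sparse set\<close>

lemma connected_punctured_plane: "connected (- {0::complex})"
  by (rule connected_punctured_universe) simp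

text \<open>On a connected domain a meromorphic function either equals 0 off a sparse set or avoids
  0 off a sparse set. One point w whose argument lies in the unit disc excludes the first
  alternative.\<close>

lemma qpoch_inf_nonzero_cosparse:
  assumes q: "0 < q" "q < 1" and g: "g analytic_on - {0}"
    and w: "w \<noteq> 0" "norm (g w) < 1"
  shows "\<forall>\<^sub>\<approx>z\<in>- {0}. qpoch_inf (g z) q \<noteq> 0"
proof -
  let ?h = "\<lambda>z. qpoch_inf (g z) q"
  have an: "?h analytic_on - {0}"
    by (rule analytic_on_qpoch_inf [OF q g])
  have "\<not> (\<forall>\<^sub>\<approx>z\<in>- {0}. ?h z = 0)"
  proof
    assume "\<forall>\<^sub>\<approx>z\<in>- {0}. ?h z = 0"
    then have ev: "eventually (\<lambda>z. ?h z = 0) (at w)"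
      using w by (intro eventually_cosparse_imp_eventually_at) auto
    \<comment> \<open>Vanishing near w says nothing about w itself; continuity carries it over to
      the value at w.\<close>
    have "isCont ?h w"
      using an w by (meson ComplI analytic_at_imp_isCont analytic_on_analytic_at singletonD)
    then have "(?h \<longlongrightarrow> ?h w) (at w)"
      by (simp add: isCont_def)
    moreover have "(?h \<longlongrightarrow> 0) (at w)"
      using ev by (rule tendsto_eventually)
    ultimately have "?h w = 0"
      by (meson LIM_unique)
    with qpoch_inf_nonzero [OF q w(2)] show False by simp
  qed
  then show ?thesis
    using meromorphic_imp_constant_or_avoid [OF analytic_on_imp_meromorphic_on [OF an], of 0]
      connected_punctured_plane by auto
qed

text \<open>A positive exponent makes the argument small near 0, and w = 1/(|a|+1) is small enough.
  The case n = 0 serves the parameters, n = 1 the symbol of qz^2.\<close>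

lemma qpoch_inf_nonzero_cosparse_mult:
  assumes q: "0 < q" "q < 1"
  shows "\<forall>\<^sub>\<approx>z\<in>- {0}. qpoch_inf (a * z ^ Suc n) q \<noteq> 0"
proof -
  define w where "w = complex_of_real (1 / (norm a + 1))"
  have r: "0 < 1 / (norm a + 1)" "1 / (norm a + 1) \<le> 1"
    by (auto simp: field_simps add_pos_nonneg)
  have "norm w = 1 / (norm a + 1)"
    unfolding w_def norm_of_real using r by simp
  then have w: "0 < norm w" "norm w \<le> 1" and aw: "norm a * norm w < 1"
    using r by (auto simp: field_simps add_pos_nonneg)
  have "norm (a * w ^ Suc n) \<le> norm a * norm w"
    unfolding norm_mult norm_power power_Suc using w
    by (intro mult_left_mono) (auto simp: mult_left_le power_le_one)
  then have "norm (a * w ^ Suc n) < 1"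
    using aw by linarith
  then show ?thesis
    using w by (intro qpoch_inf_nonzero_cosparse [OF q, where w = w]) (auto intro!: analytic_intros)
qed

text \<open>Here the argument is small far from 0, and w = |a|+1 is far enough.\<close>

lemma qpoch_inf_nonzero_cosparse_divide:
  assumes q: "0 < q" "q < 1"
  shows "\<forall>\<^sub>\<approx>z\<in>- {0}. qpoch_inf (a * inverse (z ^ Suc n)) q \<noteq> 0"
proof -
  define w where "w = complex_of_real (norm a + 1)"
  have nw: "norm w = norm a + 1"
    unfolding w_def norm_of_real by simp
  have "norm a < norm w * 1"
    using nw by simp
  also have "\<dots> \<le> norm w * norm w ^ n"
    using nw by (intro mult_left_mono one_le_power) auto
  finally have "norm a < norm (w ^ Suc n)"
    by (simp add: norm_mult norm_power)
  then have "norm (a * inverse (w ^ Suc n)) < 1"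
    unfolding divide_inverse [symmetric] norm_divide
    by (subst divide_less_eq_1_pos) (auto intro: le_less_trans [OF norm_ge_zero])
  moreover have "w \<noteq> 0"
    using nw by (metis add_nonneg_pos norm_eq_zero norm_ge_zero order_less_irrefl zero_less_one)
  ultimately show ?thesis
    by (intro qpoch_inf_nonzero_cosparse [OF q, where w = w]) (auto intro!: analytic_intros)
qed

section \<open>Laurent polynomials\<close>

text \<open>Symmetry is dropped because the intermediate functions lack it. A polynomial over a
  power of z reduces the removal of zeros to divisibility of polynomials.\<close>

definition laurent_poly :: "(complex \<Rightarrow> complex) \<Rightarrow> bool" where
  "laurent_poly f \<longleftrightarrow> (\<exists>n p. \<forall>z. z \<noteq> 0 \<longrightarrow> f z = poly p z / z ^ n)"

lemma laurent_polyI: "(\<And>z. z \<noteq> 0 \<Longrightarrow> f z = poly p z / z ^ n) \<Longrightarrow> laurent_poly f"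
  unfolding laurent_poly_def by blast

lemma laurent_poly_inverse: "laurent_poly inverse"
  by (rule laurent_polyI [of _ 1 1]) (simp add: field_simps)

lemma laurent_poly_add:
  assumes "laurent_poly f" "laurent_poly g"
  shows "laurent_poly (\<lambda>z. f z + g z)"
proof -
  obtain n p m r where "\<And>z. z \<noteq> 0 \<Longrightarrow> f z = poly p z / z ^ n"
    and "\<And>z. z \<noteq> 0 \<Longrightarrow> g z = poly r z / z ^ m"
    using assms unfolding laurent_poly_def by blast
  then show ?thesis
    by (intro laurent_polyI [of _ "p * monom 1 m + r * monom 1 n" "n + m"])
       (auto simp: poly_monom field_simps power_add)
qed

lemma laurent_poly_mult:
  assumes "laurent_poly f" "laurent_poly g"
  shows "laurent_poly (\<lambda>z. f z * g z)"
proof -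
  obtain n p m r where "\<And>z. z \<noteq> 0 \<Longrightarrow> f z = poly p z / z ^ n"
    and "\<And>z. z \<noteq> 0 \<Longrightarrow> g z = poly r z / z ^ m"
    using assms unfolding laurent_poly_def by blast
  then show ?thesis
    by (intro laurent_polyI [of _ "p * r" "n + m"]) (auto simp: power_add)
qed

lemma laurent_poly_const: "laurent_poly (\<lambda>z. c)"
  by (rule laurent_polyI [of _ "[:c:]" 0]) simp

lemma laurent_poly_cmult: "laurent_poly f \<Longrightarrow> laurent_poly (\<lambda>z. c * f z)"
  by (intro laurent_poly_mult laurent_poly_const)

lemma laurent_poly_diff:
  assumes "laurent_poly f" "laurent_poly g"
  shows "laurent_poly (\<lambda>z. f z - g z)"
  using laurent_poly_add [OF assms(1) laurent_poly_cmult [OF assms(2), of "-1"]] by simp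

lemma laurent_poly_scale:
  assumes "laurent_poly f" "s \<noteq> 0"
  shows "laurent_poly (\<lambda>z. f (s * z))"
proof -
  obtain n p where "\<And>z. z \<noteq> 0 \<Longrightarrow> f z = poly p z / z ^ n"
    using assms unfolding laurent_poly_def by blast
  then show ?thesis
    using assms(2)
    by (intro laurent_polyI [of _ "smult (1 / s ^ n) (pcompose p [:0, s:])" n])
       (auto simp: poly_pcompose power_mult_distrib mult.commute)
qed

lemma laurent_poly_reflect:
  assumes "laurent_poly f"
  shows "laurent_poly (\<lambda>z. f (inverse z))"
proof -
  obtain n p where "\<And>z. z \<noteq> 0 \<Longrightarrow> f z = poly p z / z ^ n"
    using assms unfolding laurent_poly_def by blast
  then show ?thesis
    \<comment> \<open>For nonzero z, p(1/z) is the reflected polynomial over z^(degree p), and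
      dividing by (1/z)^n multiplies by z^n.\<close>
    by (intro laurent_polyI [of _ "reflect_poly p * monom 1 n" "degree p"])
       (auto simp: poly_reflect_poly_nz poly_monom power_inverse divide_inverse)
qed

lemma laurent_poly_power: "laurent_poly f \<Longrightarrow> laurent_poly (\<lambda>z. f z ^ n)"
  by (induction n) (auto intro: laurent_poly_const laurent_poly_mult)

lemma laurent_poly_id: "laurent_poly (\<lambda>z. z)"
  by (rule laurent_polyI [of _ "[:0, 1:]" 0]) simp

lemma laurent_poly_powi: "laurent_poly (\<lambda>z. z powi k)"
  unfolding power_int_def
  by (cases "k \<ge> 0") (auto intro!: laurent_poly_power laurent_poly_id laurent_poly_inverse)

lemma laurent_poly_sum:
  "(\<And>k. k \<in> A \<Longrightarrow> laurent_poly (f k)) \<Longrightarrow> laurent_poly (\<lambda>z. \<Sum>k\<in>A. f k z)"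
  by (induction A rule: infinite_finite_induct) (auto intro: laurent_poly_const laurent_poly_add)

lemma laurent_poly_cong:
  "laurent_poly g \<Longrightarrow> (\<And>z. z \<noteq> 0 \<Longrightarrow> f z = g z) \<Longrightarrow> laurent_poly f"
  unfolding laurent_poly_def by metis

lemma laurent_poly_analytic:
  assumes "laurent_poly f"
  shows "f analytic_on - {0}"
proof -
  obtain n p where "\<And>z. z \<noteq> 0 \<Longrightarrow> f z = poly p z / z ^ n"
    using assms unfolding laurent_poly_def by blast
  then have "f holomorphic_on - {0} \<longleftrightarrow> (\<lambda>z. poly p z / z ^ n) holomorphic_on - {0}"
    by (intro holomorphic_cong) auto
  then show ?thesis
    by (subst analytic_on_open) (auto intro!: holomorphic_intros)
qed

text \<open>A nonzero root of f is a root of its numerator, because the power of z below does not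
  vanish there.\<close>

lemma laurent_poly_factor:
  assumes "laurent_poly f" "f \<alpha> = 0" "\<alpha> \<noteq> 0"
  obtains g where "laurent_poly g" "\<And>z. z \<noteq> 0 \<Longrightarrow> f z = (z - \<alpha>) * g z"
proof -
  obtain n p where p: "\<And>z. z \<noteq> 0 \<Longrightarrow> f z = poly p z / z ^ n"
    using assms unfolding laurent_poly_def by blast
  then have "poly p \<alpha> = 0"
    using assms by auto
  then obtain r where "p = [:- \<alpha>, 1:] * r"
    unfolding poly_eq_0_iff_dvd by (elim dvdE)
  then have "poly p z = (z - \<alpha>) * poly r z" for z
    by (simp only: poly_mult) simp
  then have "\<And>z. z \<noteq> 0 \<Longrightarrow> f z = (z - \<alpha>) * (poly r z / z ^ n)"
    using p by simp
  moreover have "laurent_poly (\<lambda>z. poly r z / z ^ n)"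
    by (rule laurent_polyI) (rule refl)
  ultimately show thesis using that by blast
qed

text \<open>Two linear factors are removed in turn; the second root survives the first removal since
  \<alpha> and -\<alpha> are distinct. It is used with \<alpha>^2 = 1/q and with \<alpha> =
  1.\<close>

lemma laurent_poly_factor2:
  assumes "laurent_poly f" "f \<alpha> = 0" "f (- \<alpha>) = 0" "\<alpha> \<noteq> 0"
  obtains g where "laurent_poly g" "\<And>z. z \<noteq> 0 \<Longrightarrow> f z = (z\<^sup>2 - \<alpha>\<^sup>2) * g z"
proof -
  obtain h where h: "laurent_poly h" "\<And>z. z \<noteq> 0 \<Longrightarrow> f z = (z - \<alpha>) * h z"
    using laurent_poly_factor [OF assms(1,2,4)] by blast
  have "h (- \<alpha>) = 0"
    using h(2) [of "- \<alpha>"] assms by auto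
  then obtain g where g: "laurent_poly g" "\<And>z. z \<noteq> 0 \<Longrightarrow> h z = (z - (- \<alpha>)) * g z"
    using laurent_poly_factor [OF h(1), of "- \<alpha>"] assms(4) by auto
  have "f z = (z\<^sup>2 - \<alpha>\<^sup>2) * g z" if "z \<noteq> 0" for z
    using h(2) g(2) that by (simp add: power2_eq_square algebra_simps)
  with g(1) show thesis using that by blast
qed

text \<open>Replaces symmetric coefficients by invariance under inversion, which is easy to check.
  In the converse direction, averaging an arbitrary coefficient family with its reflection makes it
  symmetric, so uniqueness of coefficients never enters.\<close>

lemma symmetric_laurent_poly_iff:
  "symmetric_laurent_poly f \<longleftrightarrow> laurent_poly f \<and> (\<forall>z. z \<noteq> 0 \<longrightarrow> f (inverse z) = f z)"
proof (intro iffI conjI allI impI)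
  assume "symmetric_laurent_poly f"
  then obtain n :: nat and c :: "int \<Rightarrow> complex" where c: "\<And>k. c k = c (- k)"
    and f: "\<And>z. z \<noteq> 0 \<Longrightarrow> f z = (\<Sum>k = - int n..int n. c k * z powi k)"
    unfolding symmetric_laurent_poly_def by blast
  show "laurent_poly f"
    by (rule laurent_poly_cong [OF _ f])
       (auto intro!: laurent_poly_sum laurent_poly_cmult laurent_poly_powi)
  fix z :: complex
  assume "z \<noteq> 0"
  have "f (inverse z) = (\<Sum>k = - int n..int n. c k * inverse z powi k)"
    using \<open>z \<noteq> 0\<close> by (intro f) auto
  also have "\<dots> = (\<Sum>k = - int n..int n. c k * z powi k)"
    by (rule sum.reindex_bij_witness [of _ uminus uminus])
       (auto simp: power_int_minus power_int_inverse c [symmetric])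
  finally show "f (inverse z) = f z"
    using f \<open>z \<noteq> 0\<close> by simp
next
  assume a: "laurent_poly f \<and> (\<forall>z. z \<noteq> 0 \<longrightarrow> f (inverse z) = f z)"
  then obtain m p where p: "\<And>z. z \<noteq> 0 \<Longrightarrow> f z = poly p z / z ^ m"
    unfolding laurent_poly_def by blast
  \<comment> \<open>The exponents of f lie between -m and degree p - m, and the symmetric range from
    -n to n contains both ends.\<close>
  define n where "n = m + degree p"
  \<comment> \<open>The case split matters: below -m, \<open>nat\<close> would return 0 and yield
    the constant coefficient of p.\<close>
  define e where "e = (\<lambda>k. if - int m \<le> k then coeff p (nat (k + int m)) else 0)"
  have e: "f z = (\<Sum>k = - int n..int n. e k * z powi k)" if "z \<noteq> 0" for z
  proof -
    have "f z = (\<Sum>i\<le>degree p. coeff p i * z ^ i) / z ^ m"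
      using p [OF that] by (simp add: poly_altdef)
    also have "\<dots> = (\<Sum>i\<le>degree p. coeff p i * z powi (int i - int m))"
      using that by (simp add: sum_divide_distrib power_int_diff)
    also have "\<dots> = (\<Sum>k = - int m..int (degree p) - int m. e k * z powi k)"
      by (rule sum.reindex_bij_witness [of _ "\<lambda>k. nat (k + int m)" "\<lambda>i. int i - int m"])
         (auto simp: e_def)
    also have "\<dots> = (\<Sum>k = - int n..int n. e k * z powi k)"
      by (rule sum.mono_neutral_left) (auto simp: e_def n_def coeff_eq_0)
    finally show ?thesis .
  qed
  define c where "c = (\<lambda>k. (e k + e (- k)) / 2)"
  have "f z = (\<Sum>k = - int n..int n. c k * z powi k)" if "z \<noteq> 0" for z
  proof -
    have "(\<Sum>k = - int n..int n. e k * inverse z powi k) = (\<Sum>k = - int n..int n. e (- k) * z powi k)"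
      by (rule sum.reindex_bij_witness [of _ uminus uminus])
         (auto simp: power_int_minus power_int_inverse)
    then have "f (inverse z) = (\<Sum>k = - int n..int n. e (- k) * z powi k)"
      using e [of "inverse z"] that by simp
    moreover have "f z = (f z + f (inverse z)) / 2"
      using a that by simp
    ultimately show ?thesis
      unfolding c_def
      by (simp add: e [OF that] sum.distrib [symmetric] sum_divide_distrib ring_distribs add_divide_distrib)
  qed
  moreover have "c k = c (- k)" for k
    by (simp add: c_def add.commute)
  ultimately show "symmetric_laurent_poly f"
    unfolding symmetric_laurent_poly_def by blast
qed

lemma symmetric_laurent_poly_analytic:
  assumes "symmetric_laurent_poly f" "g analytic_on - {0}" "\<And>z. z \<noteq> 0 \<Longrightarrow> g z \<noteq> 0"
  shows "(\<lambda>z. f (g z)) analytic_on - {0}"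
  using analytic_on_compose_gen [OF assms(2) laurent_poly_analytic, of f] assms
  by (simp add: symmetric_laurent_poly_iff o_def)

lemma symmetric_laurent_poly_X_op:
  assumes "symmetric_laurent_poly f"
  shows "symmetric_laurent_poly (X_op f)"
proof -
  have "laurent_poly (\<lambda>z. (1/2 * (z + inverse z)) * f z)"
    using assms unfolding symmetric_laurent_poly_iff
    by (intro laurent_poly_mult laurent_poly_cmult laurent_poly_add laurent_poly_id laurent_poly_inverse)
       auto
  then show ?thesis
    using assms by (auto simp: symmetric_laurent_poly_iff X_op_def add.commute intro: laurent_poly_cong)
qed

section \<open>The gauge factors\<close>

text \<open>P abstracts the symbol of base q^2 to its recurrence. Passing to qz sends qaz to q^2 az,
  one recurrence step past az, while qa/z becomes a/z and cancels; passing to z/q exchanges the two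
  roles.\<close>

lemma qpoch_pair_ratio:
  fixes P :: "complex \<Rightarrow> complex"
  assumes rec: "\<And>u. P u = (1 - u) * P (q\<^sup>2 * u)"
    and "q \<noteq> 0" "z \<noteq> 0" "P (a * z) \<noteq> 0" "P (a * inverse z) \<noteq> 0"
  shows "P (a * z) * P (a * inverse z)
           / (P (q * a * (q * z)) * P (q * a * inverse (q * z))) = 1 - a * z"
    and "P (a * z) * P (a * inverse z)
           / (P (q * a * (inverse q * z)) * P (q * a * inverse (inverse q * z))) = 1 - a / z"
proof -
  have e: "q * a * (q * z) = q\<^sup>2 * (a * z)" "q * a * inverse (q * z) = a * inverse z"
      "q * a * (inverse q * z) = a * z" "q * a * inverse (inverse q * z) = q\<^sup>2 * (a * inverse z)"
    using assms by (auto simp: field_simps power2_eq_square)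
  show "P (a * z) * P (a * inverse z)
           / (P (q * a * (q * z)) * P (q * a * inverse (q * z))) = 1 - a * z"
    unfolding e using rec [of "a * z"] assms(2-) by auto
  show "P (a * z) * P (a * inverse z)
           / (P (q * a * (inverse q * z)) * P (q * a * inverse (inverse q * z))) = 1 - a / z"
    unfolding e using rec [of "a * inverse z"] assms(2-) by (auto simp: divide_inverse [symmetric])
qed

text \<open>Passing to qz moves qz^2 one step forward and q/z^2 one step back, so one factor is lost
  and one gained: (1 - 1/(qz^2)) / (1 - qz^2) = -1/(qz^2).\<close>

lemma qpoch_square_ratio:
  fixes P :: "complex \<Rightarrow> complex"
  assumes rec: "\<And>u. P u = (1 - u) * P (q\<^sup>2 * u)"
    and nz: "q \<noteq> 0" "z \<noteq> 0" "P (q * z\<^sup>2) \<noteq> 0" "P (q * inverse (z\<^sup>2)) \<noteq> 0"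
  shows "P (q * (q * z)\<^sup>2) * P (q * inverse ((q * z)\<^sup>2))
           / (P (q * z\<^sup>2) * P (q * inverse (z\<^sup>2))) = - inverse (q * z\<^sup>2)"
    and "P (q * (inverse q * z)\<^sup>2) * P (q * inverse ((inverse q * z)\<^sup>2))
           / (P (q * z\<^sup>2) * P (q * inverse (z\<^sup>2))) = - (z\<^sup>2 / q)"
proof -
  have *: "P (q * (q * z)\<^sup>2) * P (q * inverse ((q * z)\<^sup>2))
           / (P (q * z\<^sup>2) * P (q * inverse (z\<^sup>2))) = - inverse (q * z\<^sup>2)"
    \<comment> \<open>Stated for every such z because the second claim is this one at 1/z.\<close>
    if nz: "z \<noteq> 0" "P (q * z\<^sup>2) \<noteq> 0" "P (q * inverse (z\<^sup>2)) \<noteq> 0" for z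
  proof -
    have e: "q * (q * z)\<^sup>2 = q\<^sup>2 * (q * z\<^sup>2)" "q\<^sup>2 * (q * inverse ((q * z)\<^sup>2)) = q * inverse (z\<^sup>2)"
      using nz \<open>q \<noteq> 0\<close> by (auto simp: field_simps power2_eq_square)
    have r1: "P (q * z\<^sup>2) = (1 - q * z\<^sup>2) * P (q * (q * z)\<^sup>2)"
      by (subst rec) (simp only: e(1))
    have r2: "P (q * inverse ((q * z)\<^sup>2)) = (1 - q * inverse ((q * z)\<^sup>2)) * P (q * inverse (z\<^sup>2))"
      by (subst rec) (simp only: e(2))
    have nz': "1 - q * z\<^sup>2 \<noteq> 0" "P (q * (q * z)\<^sup>2) \<noteq> 0"
      using r1 nz by auto
    have "P (q * (q * z)\<^sup>2) * P (q * inverse ((q * z)\<^sup>2)) / (P (q * z\<^sup>2) * P (q * inverse (z\<^sup>2)))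
        = (1 - q * inverse ((q * z)\<^sup>2)) / (1 - q * z\<^sup>2)"
      unfolding r1 r2 using nz nz' by simp
    also have "\<dots> = - inverse (q * z\<^sup>2)"
      using nz' nz \<open>q \<noteq> 0\<close> by (simp add: field_simps power2_eq_square)
    finally show ?thesis .
  qed
  show "P (q * (q * z)\<^sup>2) * P (q * inverse ((q * z)\<^sup>2))
           / (P (q * z\<^sup>2) * P (q * inverse (z\<^sup>2))) = - inverse (q * z\<^sup>2)"
    using * [of z] nz by blast
  show "P (q * (inverse q * z)\<^sup>2) * P (q * inverse ((inverse q * z)\<^sup>2))
           / (P (q * z\<^sup>2) * P (q * inverse (z\<^sup>2))) = - (z\<^sup>2 / q)"
    using * [of "inverse z"] nz
    by (simp add: power_inverse power_mult_distrib mult.commute divide_inverse)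
qed

text \<open>Pointwise form of the first identity: the gauge factor at z is moved inside the
  difference and cancelled against those at qz and z/q.\<close>

lemma L_op_eq_qdiff:
  fixes q :: real
  defines "Q \<equiv> complex_of_real q"
  assumes q: "0 < q" "q < 1" and z: "z \<noteq> 0"
    and nz: "\<And>u. u \<in> {a, b, c, d} \<Longrightarrow> qpoch_inf (u * z) (q\<^sup>2) \<noteq> 0"
            "\<And>u. u \<in> {a, b, c, d} \<Longrightarrow> qpoch_inf (u * inverse z) (q\<^sup>2) \<noteq> 0"
            "qpoch_inf (Q * z\<^sup>2) (q\<^sup>2) \<noteq> 0" "qpoch_inf (Q * inverse (z\<^sup>2)) (q\<^sup>2) \<noteq> 0"
  shows "L_op q a b c d f z = 1/2 * (1 - Q\<^sup>2)
                 * (qpochs_inf [a*z, a * inverse z, b*z, b * inverse z,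
                                c*z, c * inverse z, d*z, d * inverse z] (q\<^sup>2)
                    / qpochs_inf [Q * z\<^sup>2, Q * z powi (-2)] (q\<^sup>2))
                 * divided_qdiff (q\<^sup>2)
                     (\<lambda>w. qpochs_inf [Q * w\<^sup>2, Q * w powi (-2)] (q\<^sup>2) * f w
                        / qpochs_inf [Q*a*w, Q*a * inverse w, Q*b*w, Q*b * inverse w,
                                      Q*c*w, Q*c * inverse w, Q*d*w, Q*d * inverse w] (q\<^sup>2)) z"
proof -
  define P where "P = (\<lambda>u. qpoch_inf u (q\<^sup>2))"
  have q2: "0 < q\<^sup>2" "q\<^sup>2 < 1"
    using q by (auto simp: power_less_one_iff)
  have rec: "P u = (1 - u) * P (Q\<^sup>2 * u)" for u
    unfolding P_def Q_def using qpoch_inf_rec [OF q2, of u] by simp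
  have Q: "Q \<noteq> 0" "Q\<^sup>2 \<noteq> 1"
    using q q2 by (auto simp: Q_def simp flip: of_real_power)
  define A where "A = (\<lambda>u. P (u * z) * P (u * inverse z))"
  define B where "B = (\<lambda>u w. P (Q * u * w) * P (Q * u * inverse w))"
  define T where "T = (\<lambda>w. P (Q * w\<^sup>2) * P (Q * inverse (w\<^sup>2)))"
  define G where "G = (\<lambda>w. T w * f w / (B a w * B b w * B c w * B d w))"
  have AB: "A u / B u (Q * z) = 1 - u * z" "A u / B u (inverse Q * z) = 1 - u / z"
    if "u \<in> {a, b, c, d}" for u
    using qpoch_pair_ratio [where P = P and z = z and a = u, OF rec Q(1) z] nz(1,2) [OF that]
    by (auto simp: A_def B_def P_def)
  have TT: "T (Q * z) / T z = - inverse (Q * z\<^sup>2)" "T (inverse Q * z) / T z = - (z\<^sup>2 / Q)"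
    using qpoch_square_ratio [where P = P and z = z, OF rec Q(1) z] nz(3,4)
    by (auto simp: T_def P_def)
  \<comment> \<open>Pairs each symbol at z with its counterpart at w, leaving only the quotients
    that \<open>AB\<close> and \<open>TT\<close> evaluate.\<close>
  have G: "A a * A b * A c * A d / T z * G w
         = (A a / B a w) * (A b / B b w) * (A c / B c w) * (A d / B d w) * (T w / T z) * f w" for w
    by (simp add: G_def mult_ac)
  \<comment> \<open>The difference operator has base q^2, so its half-step is q itself.\<close>
  have Qpow: "complex_of_real ((q\<^sup>2) powr (1/2)) = Q" "complex_of_real ((q\<^sup>2) powr (- 1/2)) = inverse Q"
    using q by (auto simp: Q_def powr_half_sqrt powr_minus simp flip: of_real_inverse)
  have "1/2 * (1 - Q\<^sup>2) * (A a * A b * A c * A d / T z) * divided_qdiff (q\<^sup>2) G z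
      = 1/2 * (1 - Q\<^sup>2) * 2 / ((Q - inverse Q) * (z - inverse z))
         * (A a * A b * A c * A d / T z * G (Q * z) - A a * A b * A c * A d / T z * G (inverse Q * z))"
    unfolding divided_qdiff_def of_real_diff Qpow
    by (simp only: divide_inverse inverse_mult_distrib) algebra
  also have "1/2 * (1 - Q\<^sup>2) * 2 / ((Q - inverse Q) * (z - inverse z)) = - Q / (z - inverse z)"
  proof -
    have "1 - Q\<^sup>2 = - Q * (Q - inverse Q)" "Q - inverse Q \<noteq> 0"
      using Q by (auto simp: field_simps power2_eq_square)
    then show ?thesis by simp
  qed
  \<comment> \<open>The prefactor -q turns the ratios -1/(qz^2) and -z^2/q of \<open>TT\<close> into
    the weights z^(-2) and z^2 of L.\<close>
  also have "- Q / (z - inverse z)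
         * (A a * A b * A c * A d / T z * G (Q * z) - A a * A b * A c * A d / T z * G (inverse Q * z))
      = L_op q a b c d f z"
  proof -
    have "- Q / m * (A1 * (- inverse (Q * z\<^sup>2)) * s - A2 * (- (z\<^sup>2 / Q)) * t)
        = (A1 * z powi (-2) * s - A2 * z\<^sup>2 * t) / m" for A1 A2 s t m
      using Q z by (simp add: power_int_minus divide_simps)
    then show ?thesis
      unfolding G L_op_def by (simp add: AB TT Q_def [symmetric] del: mult_minus_right)
  qed
  finally show ?thesis
    unfolding G_def A_def B_def T_def P_def qpochs_inf_def
    by (simp add: power_int_minus mult.assoc)
qed

section \<open>The Askey-Wilson operator\<close>

lemma power2_neq_cosparse: "\<forall>\<^sub>\<approx>z\<in>- {0::complex}. z\<^sup>2 \<noteq> u"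
proof -
  have "{z. z\<^sup>2 = u} \<subseteq> {csqrt u, - csqrt u}"
    using power2_eq_iff [of _ "csqrt u"] by auto
  then have "finite {z. z\<^sup>2 = u}"
    by (rule finite_subset) auto
  then show ?thesis
    by (simp add: eventually_cosparse finite_imp_sparse)
qed

lemma nonzero_cosparse: "\<forall>\<^sub>\<approx>z\<in>- {0::complex}. z \<noteq> 0"
  by (rule eventually_mono [OF eventually_in_cosparse [of "- {0}" "- {0}"]]) auto

text \<open>Meromorphy passes to any function agreeing off a sparse set, so it is verified only on
  the simpler side.\<close>

lemma meromorphic_eqI:
  assumes "g meromorphic_on - {0}" "\<forall>\<^sub>\<approx>z\<in>- {0}. g z = h z"
  shows "meromorphic_eq g h"
  using assms meromorphic_on_cong' [OF assms(2) refl] unfolding meromorphic_eq_def by blast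

lemma L_op_meromorphic:
  assumes "symmetric_laurent_poly f" "q \<noteq> 0"
  shows "L_op q a b c d f meromorphic_on - {0}"
proof -
  have f: "(\<lambda>z. f (s * z)) meromorphic_on - {0}" if "s \<noteq> 0" for s
    by (rule analytic_on_imp_meromorphic_on, rule symmetric_laurent_poly_analytic [OF assms(1)])
       (use that in \<open>auto intro: analytic_on_mult analytic_on_const analytic_on_ident\<close>)
  have "(\<lambda>z. L_op q a b c d f z) meromorphic_on - {0}"
    unfolding L_op_def by (intro meromorphic_intros f) (use assms(2) in auto)
  then show ?thesis by simp
qed

text \<open>The pointwise identity applies away from the zeros of ten Pochhammer symbols, and
  finitely many sparse sets have a sparse union.\<close>

lemma L_op_meromorphic_eq_qdiff:
  fixes q :: real and a b c d :: complex
  assumes q: "0 < q" "q < 1" and f: "symmetric_laurent_poly f"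
  shows "meromorphic_eq
              (L_op q a b c d f)
              (\<lambda>z. 1/2 * (1 - (complex_of_real q)\<^sup>2)
                 * (qpochs_inf [a*z, a * inverse z, b*z, b * inverse z,
                                c*z, c * inverse z, d*z, d * inverse z] (q\<^sup>2)
                    / qpochs_inf [q * z\<^sup>2, q * z powi (-2)] (q\<^sup>2))
                 * divided_qdiff (q\<^sup>2)
                     (\<lambda>w. qpochs_inf [q * w\<^sup>2, q * w powi (-2)] (q\<^sup>2) * f w
                        / qpochs_inf [q*a*w, q*a * inverse w, q*b*w, q*b * inverse w,
                                      q*c*w, q*c * inverse w, q*d*w, q*d * inverse w] (q\<^sup>2)) z)"
    (is "meromorphic_eq _ ?h")
proof (rule meromorphic_eqI [OF L_op_meromorphic [OF f]])
  have q2: "0 < q\<^sup>2" "q\<^sup>2 < 1"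
    using q by (auto simp: power_less_one_iff)
  have "\<forall>\<^sub>\<approx>z\<in>- {0}. \<forall>u\<in>{a, b, c, d}. qpoch_inf (u * z) (q\<^sup>2) \<noteq> 0"
    using qpoch_inf_nonzero_cosparse_mult [OF q2, of _ 0]
    by (intro eventually_ball_finite) auto
  moreover have "\<forall>\<^sub>\<approx>z\<in>- {0}. \<forall>u\<in>{a, b, c, d}. qpoch_inf (u * inverse z) (q\<^sup>2) \<noteq> 0"
    using qpoch_inf_nonzero_cosparse_divide [OF q2, of _ 0]
    by (intro eventually_ball_finite) auto
  moreover have "\<forall>\<^sub>\<approx>z\<in>- {0::complex}. qpoch_inf (q * z\<^sup>2) (q\<^sup>2) \<noteq> 0"
    using qpoch_inf_nonzero_cosparse_mult [OF q2, of q 1] by (simp only: flip: numeral_2_eq_2 Suc_1)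
  moreover have "\<forall>\<^sub>\<approx>z\<in>- {0::complex}. qpoch_inf (q * inverse (z\<^sup>2)) (q\<^sup>2) \<noteq> 0"
    using qpoch_inf_nonzero_cosparse_divide [OF q2, of q 1] by (simp only: flip: numeral_2_eq_2 Suc_1)
  ultimately show "\<forall>\<^sub>\<approx>z\<in>- {0}. L_op q a b c d f z = ?h z"
    using nonzero_cosparse
  proof eventually_elim
    case (elim z)
    then show ?case
      by (intro L_op_eq_qdiff [OF q]) auto
  qed
qed (use q in auto)

section \<open>Existence of the Askey-Wilson operator\<close>

lemma askey_wilson_image_exists:
  fixes q :: real
  defines "Q \<equiv> complex_of_real q"
  assumes q: "0 < q" "q < 1" and f: "symmetric_laurent_poly f"
  shows "\<exists>g. symmetric_laurent_poly g \<and>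
    meromorphic_eq (\<lambda>z. 1/2 * (1 - inverse Q) * g z)
      (\<lambda>z. AW_v q a b c d z * f (Q * z) - (AW_v q a b c d z + AW_v q a b c d (inverse z)) * f z
           + AW_v q a b c d (inverse z) * f (inverse Q * z))"
proof -
  have lf: "laurent_poly f" and sf: "\<And>z. z \<noteq> 0 \<Longrightarrow> f (inverse z) = f z"
    using f by (auto simp: symmetric_laurent_poly_iff)
  have Q: "Q \<noteq> 0" "Q \<noteq> 1"
    using q by (auto simp: Q_def)
  define A where "A = (\<lambda>z. (1 - a*z) * (1 - b*z) * (1 - c*z) * (1 - d*z))"
  \<comment> \<open>A root of qz^2 = 1; the other is its negative.\<close>
  define \<alpha> where "\<alpha> = inverse (complex_of_real (sqrt q))"
  have "Q = (complex_of_real (sqrt q))\<^sup>2"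
    using q by (simp add: Q_def flip: of_real_power)
  then have \<alpha>: "\<alpha> \<noteq> 0" "\<alpha>\<^sup>2 = inverse Q" "Q * \<alpha> = inverse \<alpha>"
    using q by (auto simp: \<alpha>_def power_inverse power2_eq_square)
  have "laurent_poly A"
    unfolding A_def
    by (intro laurent_poly_mult laurent_poly_diff laurent_poly_const laurent_poly_id)
  then have "laurent_poly (\<lambda>z. A z * (f (Q * z) - f z))"
    using Q by (intro laurent_poly_mult laurent_poly_diff laurent_poly_scale lf)
  moreover have "f (Q * \<alpha>) = f \<alpha>" "f (Q * - \<alpha>) = f (- \<alpha>)"
    using sf [of \<alpha>] sf [of "- \<alpha>"] \<alpha> by auto
  ultimately obtain h where h: "laurent_poly h"
      "\<And>z. z \<noteq> 0 \<Longrightarrow> A z * (f (Q * z) - f z) = (z\<^sup>2 - \<alpha>\<^sup>2) * h z"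
    using laurent_poly_factor2 [of "\<lambda>z. A z * (f (Q * z) - f z)" \<alpha>] \<alpha>(1) by auto
  \<comment> \<open>The constant rescales z^2 - 1/q to 1 - qz^2.\<close>
  define P where "P = (\<lambda>z. - inverse Q * h z)"
  have lP: "laurent_poly P"
    unfolding P_def by (rule laurent_poly_cmult [OF h(1)])
  have P: "A z * (f (Q * z) - f z) = (1 - Q * z\<^sup>2) * P z" if "z \<noteq> 0" for z
    using h(2) [OF that] Q by (simp add: \<alpha> P_def field_simps)
  have vP: "AW_v q a b c d z * (f (Q * z) - f z) = P z / (1 - z\<^sup>2)"
    if "z \<noteq> 0" "Q * z\<^sup>2 \<noteq> 1" for z
    using P [of z] that unfolding AW_v_def A_def Q_def [symmetric] by (simp add: divide_simps)
  \<comment> \<open>Numerator of P(z)/(1-z^2) + P(1/z)/(1-1/z^2) over the common denominator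
    1-z^2.\<close>
  define M where "M = (\<lambda>z. P z - z\<^sup>2 * P (inverse z))"
  have "laurent_poly M"
    unfolding M_def by (intro laurent_poly_diff laurent_poly_mult laurent_poly_power
        laurent_poly_id laurent_poly_reflect lP)
  then obtain k where k: "laurent_poly k" "\<And>z. z \<noteq> 0 \<Longrightarrow> M z = (z\<^sup>2 - 1) * k z"
    using laurent_poly_factor2 [of M 1] by (auto simp: M_def)
  have sk: "k (inverse z) = k z" if "z \<noteq> 0" for z
  \<comment> \<open>At z = 1 and z = -1 the factor to be cancelled vanishes, but there 1/z =
    z.\<close>
  proof (cases "z\<^sup>2 = 1")
    case True
    then have "z = 1 \<or> z = - 1"
      by (simp add: power2_eq_1_iff)
    then show ?thesis by auto
  next
    case False
    have "z\<^sup>2 * M (inverse z) = - M z"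
      using that by (simp add: M_def field_simps)
    then have "z\<^sup>2 * ((inverse z)\<^sup>2 - 1) * k (inverse z) = - (z\<^sup>2 - 1) * k z"
      using k(2) [OF that] k(2) [of "inverse z"] that by (simp add: algebra_simps)
    moreover have "z\<^sup>2 * ((inverse z)\<^sup>2 - 1) = - (z\<^sup>2 - 1)"
      using that by (simp add: field_simps)
    ultimately show ?thesis
      using False by simp
  qed
  \<comment> \<open>Solves the defining equation of Df, whose right side reduces to M/(1-z^2) =
    -k.\<close>
  define g where "g = (\<lambda>z. - 2 / (1 - inverse Q) * k z)"
  have sg: "symmetric_laurent_poly g"
    unfolding symmetric_laurent_poly_iff g_def
    using laurent_poly_cmult [OF k(1), of "- 2 / (1 - inverse Q)"] sk by auto
  have g: "1/2 * (1 - inverse Q) * g z = - k z" for z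
    using Q by (simp add: g_def)
  have "meromorphic_eq (\<lambda>z. 1/2 * (1 - inverse Q) * g z)
      (\<lambda>z. AW_v q a b c d z * f (Q * z) - (AW_v q a b c d z + AW_v q a b c d (inverse z)) * f z
           + AW_v q a b c d (inverse z) * f (inverse Q * z))"
  proof (rule meromorphic_eqI)
    show "(\<lambda>z. 1/2 * (1 - inverse Q) * g z) meromorphic_on - {0}"
      using sg by (intro analytic_on_imp_meromorphic_on laurent_poly_analytic laurent_poly_cmult)
        (simp add: symmetric_laurent_poly_iff)
    show "\<forall>\<^sub>\<approx>z\<in>- {0}. 1/2 * (1 - inverse Q) * g z =
      AW_v q a b c d z * f (Q * z) - (AW_v q a b c d z + AW_v q a b c d (inverse z)) * f z
           + AW_v q a b c d (inverse z) * f (inverse Q * z)"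
      using nonzero_cosparse power2_neq_cosparse [of 1] power2_neq_cosparse [of "inverse Q"]
        power2_neq_cosparse [of Q]
    proof eventually_elim
      case (elim z)
      have nz: "Q * z\<^sup>2 \<noteq> 1" "Q * (inverse z)\<^sup>2 \<noteq> 1" "(inverse z)\<^sup>2 \<noteq> 1"
        using elim(1-4) Q by (auto simp: field_simps)
      \<comment> \<open>By this symmetry the z/q term is \<open>vP\<close> at 1/z.\<close>
      have "f (Q * inverse z) = f (inverse Q * z)"
        using sf [of "inverse Q * z"] elim Q by simp
      then have "AW_v q a b c d (inverse z) * (f (inverse Q * z) - f z)
          = P (inverse z) / (1 - (inverse z)\<^sup>2)"
        using vP [of "inverse z"] sf [of z] elim(1) nz by simp
      moreover have "AW_v q a b c d z * (f (Q * z) - f z) = P z / (1 - z\<^sup>2)"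
        using vP [of z] elim(1) nz by simp
      moreover have "P z / (1 - z\<^sup>2) + P (inverse z) / (1 - (inverse z)\<^sup>2) = - k z"
      proof -
        have "P (inverse z) / (1 - (inverse z)\<^sup>2) = - z\<^sup>2 * P (inverse z) / (1 - z\<^sup>2)"
          using elim by (simp add: divide_simps) (simp add: algebra_simps)
        then have "P z / (1 - z\<^sup>2) + P (inverse z) / (1 - (inverse z)\<^sup>2) = M z / (1 - z\<^sup>2)"
          by (simp add: M_def diff_divide_distrib)
        also have "\<dots> = - k z"
          using elim k(2) [of z] by (simp add: field_simps)
        finally show ?thesis .
      qed
      ultimately show ?case
        unfolding g by (simp add: algebra_simps)
    qed
  qed
  with sg show ?thesis by blast
qed

section \<open>The commutator of D and X\<close>

lemma AW_v_times_X_diff: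
  fixes q :: real
  defines "Q \<equiv> complex_of_real q"
  assumes "Q \<noteq> 0" "z \<noteq> 0" "z\<^sup>2 \<noteq> 1" "Q * z\<^sup>2 \<noteq> 1"
  shows "AW_v q a b c d z * ((Q * z + inverse (Q * z)) / 2 - (z + inverse z) / 2)
    = 1/2 * (1 - inverse Q)
        * ((1 - a*z) * (1 - b*z) * (1 - c*z) * (1 - d*z) * inverse (z\<^sup>2) / (z - inverse z))"
proof -
  define N where "N = (1 - a*z) * (1 - b*z) * (1 - c*z) * (1 - d*z)"
  have v: "AW_v q a b c d z = N / ((1 - z\<^sup>2) * (1 - Q * z\<^sup>2))"
    by (simp add: AW_v_def N_def Q_def)
  \<comment> \<open>The factor 1 - qz^2 appearing here cancels against the denominator of v, and
    \<open>y\<close> rewrites what is left in the shape of L.\<close>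
  have x: "(Q * z + inverse (Q * z)) / 2 - (z + inverse z) / 2
      = 1/2 * (1 - inverse Q) * (1 - Q * z\<^sup>2) * (- inverse z)"
    using assms by (simp add: field_simps power2_eq_square)
  have y: "inverse (1 - z\<^sup>2) * (- inverse z) = inverse (z\<^sup>2) / (z - inverse z)"
    using assms by (simp add: divide_simps) (simp add: algebra_simps power2_eq_square)
  have "N / (m * n) * (k * n * i) = k * (N * (inverse m * i))" if "n \<noteq> 0" for m n k i :: complex
    using that by (simp add: divide_inverse)
  then have "N / ((1 - z\<^sup>2) * (1 - Q * z\<^sup>2)) * (1/2 * (1 - inverse Q) * (1 - Q * z\<^sup>2) * (- inverse z))
      = 1/2 * (1 - inverse Q) * (N * (inverse (1 - z\<^sup>2) * (- inverse z)))"
    using assms(5) by (metis right_minus_eq)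
  then show ?thesis
    unfolding v x y N_def by (simp only: times_divide_eq_right)
qed

lemma L_op_eq_commutator:
  fixes q :: real
  assumes q: "0 < q" "q < 1" and D: "askey_wilson_operator q a b c d D"
    and f: "symmetric_laurent_poly f"
  shows "meromorphic_eq (L_op q a b c d f) (\<lambda>z. D (X_op f) z - X_op (D f) z)"
proof (rule meromorphic_eqI [OF L_op_meromorphic [OF f]])
  define Q where "Q = complex_of_real q"
  have Q: "Q \<noteq> 0" "Q \<noteq> 1"
    using q by (auto simp: Q_def)
  define v where "v = AW_v q a b c d"
  have D: "\<forall>\<^sub>\<approx>z\<in>- {0}. 1/2 * (1 - inverse Q) * D g z
      = v z * g (Q * z) - (v z + v (inverse z)) * g z + v (inverse z) * g (inverse Q * z)"
    if "symmetric_laurent_poly g" for g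
    using D that unfolding askey_wilson_operator_def meromorphic_eq_def Q_def v_def by blast
  show "\<forall>\<^sub>\<approx>z\<in>- {0}. L_op q a b c d f z = D (X_op f) z - X_op (D f) z"
    \<comment> \<open>D is known only through its defining equation, used at f and at Xf; the latter
      is admissible because X preserves symmetry.\<close>
    using nonzero_cosparse power2_neq_cosparse [of 1] power2_neq_cosparse [of "inverse Q"]
      power2_neq_cosparse [of Q] D [OF f] D [OF symmetric_laurent_poly_X_op [OF f]]
  proof eventually_elim
    case (elim z)
    have nz: "Q * z\<^sup>2 \<noteq> 1" "Q * (inverse z)\<^sup>2 \<noteq> 1" "(inverse z)\<^sup>2 \<noteq> 1"
      using elim(1-4) Q by (auto simp: field_simps)
    define x where "x = (\<lambda>z :: complex. (z + inverse z) / 2)"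
    define k where "k = 1/2 * (1 - inverse Q)"
    have k: "k \<noteq> 0"
      using Q by (simp add: k_def)
    have X: "X_op g w = x w * g w" for g w
      by (simp add: X_op_def x_def)
    have x: "x (inverse Q * z) = x (Q * inverse z)" "x (inverse z) = x z"
      by (simp_all add: x_def add.commute mult.commute)
    \<comment> \<open>Since x is invariant under inversion, this is the previous lemma at 1/z; the
      reversed denominator 1/z - z supplies the minus sign in L.\<close>
    have *: "v (inverse z) * (x (inverse Q * z) - x z)
        = k * ((1 - a/z) * (1 - b/z) * (1 - c/z) * (1 - d/z) * z\<^sup>2 / (inverse z - z))"
      unfolding x(1) x(2) [symmetric]
      using AW_v_times_X_diff [of q "inverse z" a b c d] elim(1) Q nz
      unfolding Q_def [symmetric] v_def x_def k_def
      by (simp add: divide_inverse [symmetric] power_inverse)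
    have **: "v z * (x (Q * z) - x z)
        = k * ((1 - a*z) * (1 - b*z) * (1 - c*z) * (1 - d*z) * inverse (z\<^sup>2) / (z - inverse z))"
      using AW_v_times_X_diff [of q z a b c d] elim(1,2) Q nz
      unfolding Q_def [symmetric] v_def x_def k_def by simp
    have "k * (D (X_op f) z - X_op (D f) z) = k * D (X_op f) z - x z * (k * D f z)"
      by (simp add: X algebra_simps)
    also have "\<dots> = v z * (x (Q * z) - x z) * f (Q * z)
        + v (inverse z) * (x (inverse Q * z) - x z) * f (inverse Q * z)"
      unfolding k_def elim(5) elim(6) X by (simp add: algebra_simps)
    also have "\<dots> = k * L_op q a b c d f z"
    proof -
      have minus: "u / (inverse z - z) = - (u / (z - inverse z))" for u
        by (metis minus_diff_eq divide_minus_right)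
      have "k * (A1 * r / (z - inverse z)) * s + k * (A2 * r' / (inverse z - z)) * t
          = k * ((A1 * r * s - A2 * r' * t) / (z - inverse z))" for A1 A2 r r' s t
        unfolding minus by (simp add: diff_divide_distrib right_diff_distrib mult.assoc)
      moreover have "inverse (z\<^sup>2) = z powi (-2)"
        by (simp add: power_int_minus)
      ultimately show ?thesis
        unfolding * ** L_op_def Q_def [symmetric] by simp
    qed
    finally show ?case
      using k by simp
  qed
qed (use q in auto)

theorem mainTheorem2:
  fixes q :: real and a b c d :: complex
  assumes "0 < q" and "q < 1"
  shows "(\<forall>f. symmetric_laurent_poly f \<longrightarrow>
            meromorphic_eq
              (L_op q a b c d f)
              (\<lambda>z. 1/2 * (1 - (complex_of_real q)\<^sup>2)
                 * (qpochs_inf [a*z, a * inverse z, b*z, b * inverse z,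
                                c*z, c * inverse z, d*z, d * inverse z] (q\<^sup>2)
                    / qpochs_inf [q * z\<^sup>2, q * z powi (-2)] (q\<^sup>2))
                 * divided_qdiff (q\<^sup>2)
                     (\<lambda>w. qpochs_inf [q * w\<^sup>2, q * w powi (-2)] (q\<^sup>2) * f w
                        / qpochs_inf [q*a*w, q*a * inverse w, q*b*w, q*b * inverse w,
                                      q*c*w, q*c * inverse w, q*d*w, q*d * inverse w] (q\<^sup>2)) z))
       \<and> (\<exists>D. askey_wilson_operator q a b c d D)
       \<and> (\<forall>D. askey_wilson_operator q a b c d D \<longrightarrow>
            (\<forall>f. symmetric_laurent_poly f \<longrightarrow>
               meromorphic_eq (L_op q a b c d f) (\<lambda>z. D (X_op f) z - X_op (D f) z)))"
proof (intro conjI allI impI)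
  show "\<exists>D. askey_wilson_operator q a b c d D"
    unfolding askey_wilson_operator_def
    \<comment> \<open>D is chosen one argument at a time; for a function that is not symmetric the
      condition is vacuous.\<close>
    by (intro choice allI) (use askey_wilson_image_exists [OF assms] in blast)
qed (erule L_op_meromorphic_eq_qdiff [OF assms] L_op_eq_commutator [OF assms]; assumption)+

end
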